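(* Let $S$ be a topological semigroup. For a non-expansive action of $S$ on a metric space $(X,d)$, the following are equivalent: (1) There exist a (real) Banach space $V$ equipped with a linear non-expansive action of $S$, and an equivariant isometric embedding of $(X,d)$ into $V$. (2) For every $x\in X$, the orbit $S\cdot x=\{s\cdot x\mid s\in S\}$ is a bounded subset of $X$.
   Context: An action of a semigroup $S$ on a set $X$ is a map $\pi:S\times X\to X$, written $\pi(s,x)=s\cdot x$, with $(st)\cdot x=s\cdot(t\cdot x)$ for all $s,t\in S$, $x\in X$. A non-expansive action of a topological semigroup $S$ on a metric space $(X,d)$ is an action such that $d(s\cdot x,s\cdot y)\le d(x,y)$ for all $s\in S$ and $x,y\in X$, and such that, in addition, the map $S\times X\to X$ is (jointly) continuous; continuity is always included in the term "non-expansive action". A non-expansive action on a real normed space $V$ (with the metric induced by the norm) is linear if for every $s\in S$ the translation map $x\mapsto s\cdot x$ is a linear map on $V$; non-expansivity then means $\|s\cdot x\|\le\|x\|$ for all $s\in S$, $x\in V$. A map $f:X\to Y$ between spaces with $S$-actions is equivariant if $f(s\cdot x)=s\cdot f(x)$ for all $s\in S$, $x\in X$. The semigroup $S$ need not have a unit, so $x$ need not belong to $S\cdot x$. *)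

theory Defs
  imports "HOL-Analysis.Analysis" "HOL-Probability.Discrete_Topology"
begin

definition nonexpansive_action ::
    "('s::topological_semigroup_mult \<Rightarrow> 'x::metric_space \<Rightarrow> 'x) \<Rightarrow> 'x set \<Rightarrow> bool"
  where "nonexpansive_action act X \<longleftrightarrow>
    (\<forall>s. \<forall>x\<in>X. act s x \<in> X) \<and>
    (\<forall>s t. \<forall>x\<in>X. act (s * t) x = act s (act t x)) \<and>
    (\<forall>s. \<forall>x\<in>X. \<forall>y\<in>X. dist (act s x) (act s y) \<le> dist x y) \<and>
    continuous_on (UNIV \<times> X) (\<lambda>(s, x). act s x)"

definition linear_nonexpansive_action ::
    "('s::topological_semigroup_mult \<Rightarrow> 'v::real_normed_vector \<Rightarrow> 'v) \<Rightarrow> 'v set \<Rightarrow> bool"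
  where "linear_nonexpansive_action \<sigma> V \<longleftrightarrow>
    nonexpansive_action \<sigma> V \<and>
    (\<forall>s. \<forall>v\<in>V. \<forall>w\<in>V. \<sigma> s (v + w) = \<sigma> s v + \<sigma> s w) \<and>
    (\<forall>s c. \<forall>v\<in>V. \<sigma> s (c *\<^sub>R v) = c *\<^sub>R \<sigma> s v)"

definition equivariant_isometric_embedding ::
    "('s \<Rightarrow> 'x::metric_space \<Rightarrow> 'x) \<Rightarrow> 'x set \<Rightarrow> ('s \<Rightarrow> 'v::metric_space \<Rightarrow> 'v) \<Rightarrow> 'v set
      \<Rightarrow> ('x \<Rightarrow> 'v) \<Rightarrow> bool"
  where "equivariant_isometric_embedding act X \<sigma> V f \<longleftrightarrow>
    f ` X \<subseteq> V \<and>
    (\<forall>x\<in>X. \<forall>y\<in>X. dist (f x) (f y) = dist x y) \<and>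
    (\<forall>s. \<forall>x\<in>X. f (act s x) = \<sigma> s (f x))"

text \<open>
  A Banach space is represented by a complete linear subspace of a type of class
  \<open>real_normed_vector\<close>, so that the carrier (and not only the type) can be quantified
  over. The space and its action live on the carrier only; nothing is required of the
  values of \<open>\<sigma> s\<close> outside \<open>V\<close>.
\<close>

definition linearizable_in ::
    "'v::real_normed_vector itself \<Rightarrow> ('s::topological_semigroup_mult \<Rightarrow> 'x::metric_space \<Rightarrow> 'x)
      \<Rightarrow> 'x set \<Rightarrow> bool"
  where "linearizable_in _ act X \<longleftrightarrow>
    (\<exists>(V :: 'v set) \<sigma> f.
      subspace V \<and> complete V \<and>
      linear_nonexpansive_action \<sigma> V \<and>
      equivariant_isometric_embedding act X \<sigma> V f)"

text \<open>
  HOL cannot quantify existentially over types, so ``there is a Banach space'' needs a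
  fixed type that is large enough. We take the Banach space of all bounded
  real functions on the set of all functions \<open>'x \<Rightarrow> real\<close>; the type constructor
  \<open>discrete\<close> makes every such function continuous. Choosing this type loses no generality:
  a Banach space with a linear action that contains an equivariant isometric copy of \<open>X\<close>
  can be replaced by the closed linear span of that copy, and this span embeds
  isometrically into the type below.
\<close>

type_synonym 'x linf_functions = "('x \<Rightarrow> real) discrete \<Rightarrow>\<^sub>C real"

end

theory Submission
  imports Defs
begin

text \<open>
  In a Banach space with a linear non-expansive action the origin is a fixed point, and
  non-expansivity keeps every orbit in a ball around it; so orbits of a linearizable action are
  bounded. Conversely, bounded orbits leave room for such an origin. Choose any point \<open>c\<close> and let
  \<open>\<rho> x\<close> be the supremum of \<open>dist z c\<close> over the point \<open>z = x\<close> and all \<open>z\<close> in the orbit of \<open>x\<close>.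
  Then \<open>\<rho> x\<close> can serve as the (possibly zero) distance from \<open>x\<close> to a new point, and the action, with the new
  point fixed, is still non-expansive because \<open>\<rho>\<close> does not increase along orbits
  (\<open>bounded_orbits_imp_invariant_gauge\<close>).

  For a non-expansive action with a fixed point, let \<open>L\<close> be the set of 1-Lipschitz real functions
  that vanish at the fixed point. It is closed under \<open>\<phi> \<mapsto> \<phi> \<circ> s\<close>. Sending \<open>x\<close> to evaluation at
  \<open>x\<close> embeds the space isometrically into the bounded functions on \<open>L\<close>, as shifted distance
  functions lie in \<open>L\<close> (\<open>dist_evaluation\<close>), and \<open>(s F) \<phi> = F (\<phi> \<circ> s)\<close> is an action by linear
  contractions for which this embedding is equivariant.

  That action need not be continuous on all bounded functions. It is continuous on the closed
  linear span of the image, the Arens-Eells (Lipschitz-free) space: the orbit map of an evaluation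
  functional is the continuous map \<open>s \<mapsto> s \<cdot> x\<close> followed by an isometry, linearity carries
  continuity to the span, and equicontinuity carries it to the closure and makes it joint
  (\<open>linear_nonexpansive_action_closed_span\<close>).
\<close>

section \<open>Extending an action by contractions to a closed span\<close>

lemma closure_subspace:
  fixes A :: "'v::real_normed_vector set"
  assumes "subspace A"
  shows "subspace (closure A)"
proof (rule subspaceI)
  show "0 \<in> closure A"
    using assms closure_subset subspace_0 by blast
next
  fix x y assume "x \<in> closure A" "y \<in> closure A"
  then obtain u v where "\<And>n. u n \<in> A" "u \<longlonglongrightarrow> x" "\<And>n. v n \<in> A" "v \<longlonglongrightarrow> y"
    by (meson closure_sequential)
  then have "(\<lambda>n. u n + v n) \<longlonglongrightarrow> x + y" "\<forall>n. u n + v n \<in> A"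
    using assms by (auto intro: tendsto_add subspace_add)
  then show "x + y \<in> closure A"
    unfolding closure_sequential by (intro exI[of _ "\<lambda>n. u n + v n"] conjI)
next
  fix c :: real and x assume "x \<in> closure A"
  then obtain u where "\<And>n. u n \<in> A" "u \<longlonglongrightarrow> x"
    by (meson closure_sequential)
  then have "(\<lambda>n. c *\<^sub>R u n) \<longlonglongrightarrow> c *\<^sub>R x" "\<forall>n. c *\<^sub>R u n \<in> A"
    using assms by (auto intro: tendsto_scaleR subspace_scale)
  then show "c *\<^sub>R x \<in> closure A"
    unfolding closure_sequential by (intro exI[of _ "\<lambda>n. c *\<^sub>R u n"] conjI)
qed

text \<open>
  If \<open>w n\<close> tends to \<open>v\<close>, then the orbit maps of \<open>w n\<close> tend to that of \<open>v\<close> uniformly in \<open>s\<close>,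
  because all \<open>\<sigma> s\<close> are contractions; so continuity survives the passage to the closure.
\<close>

lemma orbit_map_continuous_on_closed_span:
  fixes \<sigma> :: "'s::topological_space \<Rightarrow> 'v::real_normed_vector \<Rightarrow> 'v"
  assumes lin: "\<And>s. linear (\<sigma> s)"
    and contr: "\<And>s v. norm (\<sigma> s v) \<le> norm v"
    and cont: "\<And>a. a \<in> A \<Longrightarrow> continuous_on UNIV (\<lambda>s. \<sigma> s a)"
    and v: "v \<in> closure (span A)"
  shows "continuous_on UNIV (\<lambda>s. \<sigma> s v)"
proof -
  have span: "continuous_on UNIV (\<lambda>s. \<sigma> s w)" if "w \<in> span A" for w
    using that
  proof (induction rule: span_induct_alt)
    case base
    show ?case by (simp add: linear_0[OF lin])
  next
    case (step c x y)
    then show ?case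
      by (auto simp: linear_add[OF lin] linear_scale[OF lin] intro!: continuous_intros cont)
  qed
  obtain w where w: "\<And>n. w n \<in> span A" "w \<longlonglongrightarrow> v"
    using v by (meson closure_sequential)
  have "uniform_limit UNIV (\<lambda>n s. \<sigma> s (w n)) (\<lambda>s. \<sigma> s v) sequentially"
  proof (rule uniform_limitI)
    fix e :: real assume "e > 0"
    then have "\<forall>\<^sub>F n in sequentially. dist (w n) v < e"
      using w(2) by (rule tendstoD[rotated])
    then show "\<forall>\<^sub>F n in sequentially. \<forall>s\<in>UNIV. dist (\<sigma> s (w n)) (\<sigma> s v) < e"
    proof eventually_elim
      case (elim n)
      have "dist (\<sigma> s (w n)) (\<sigma> s v) \<le> dist (w n) v" for s
        using contr[of s "w n - v"] by (simp add: dist_norm linear_diff[OF lin])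
      then show ?case using elim by (meson le_less_trans)
    qed
  qed
  then show ?thesis
    by (rule uniform_limit_theorem[rotated]) (auto intro!: always_eventually span w)
qed

text \<open>
  Joint continuity comes from separate continuity through the estimate
  \<open>dist (\<sigma> t w) (\<sigma> s v) \<le> dist w v + dist (\<sigma> t v) (\<sigma> s v)\<close>, whose second term involves the
  orbit map of the fixed vector \<open>v\<close> alone.
\<close>

lemma linear_nonexpansive_action_closed_span:
  fixes \<sigma> :: "'s::topological_semigroup_mult \<Rightarrow> 'v::real_normed_vector \<Rightarrow> 'v"
  assumes lin: "\<And>s. linear (\<sigma> s)"
    and contr: "\<And>s v. norm (\<sigma> s v) \<le> norm v"
    and mult: "\<And>s t v. \<sigma> (s * t) v = \<sigma> s (\<sigma> t v)"
    and inv: "\<And>s a. a \<in> A \<Longrightarrow> \<sigma> s a \<in> A"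
    and cont: "\<And>a. a \<in> A \<Longrightarrow> continuous_on UNIV (\<lambda>s. \<sigma> s a)"
  shows "linear_nonexpansive_action \<sigma> (closure (span A))"
proof -
  let ?V = "closure (span A)"
  have nonexp: "dist (\<sigma> s v) (\<sigma> s w) \<le> dist v w" for s v w
    using contr[of s "v - w"] by (simp add: dist_norm linear_diff[OF lin])
  have bl: "bounded_linear (\<sigma> s)" for s
    using lin contr by (intro bounded_linear.intro bounded_linear_axioms.intro exI[of _ 1]) auto
  have maps: "\<sigma> s v \<in> ?V" if "v \<in> ?V" for s v
  proof -
    have "\<sigma> s ` span A = span (\<sigma> s ` A)"
      by (rule linear_span_image[OF lin, symmetric])
    also have "\<dots> \<subseteq> span A"
      using inv by (intro span_mono) auto
    finally have "closure (\<sigma> s ` span A) \<subseteq> ?V"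
      by (rule closure_mono)
    then show ?thesis
      using closure_bounded_linear_image_subset[OF bl] that by blast
  qed
  have "continuous_on (UNIV \<times> ?V) (\<lambda>(s, v). \<sigma> s v)"
    unfolding continuous_on_def
  proof safe
    fix s :: 's and v assume v: "v \<in> ?V"
    let ?F = "at (s, v) within UNIV \<times> ?V"
    have fst: "(fst \<longlongrightarrow> s) ?F" and snd: "(snd \<longlongrightarrow> v) ?F"
      by (auto intro!: tendsto_eq_intros)
    have "continuous_on UNIV (\<lambda>s. \<sigma> s v)"
      using orbit_map_continuous_on_closed_span[OF lin contr cont v] .
    then have "((\<lambda>p. \<sigma> (fst p) v) \<longlongrightarrow> \<sigma> s v) ?F"
      using fst by (rule continuous_on_tendsto_compose) auto
    then have "((\<lambda>p. dist (snd p) v + dist (\<sigma> (fst p) v) (\<sigma> s v)) \<longlongrightarrow> 0 + 0) ?F"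
      using snd by (intro tendsto_add tendsto_dist_iff[THEN iffD1])
    then have lim: "((\<lambda>p. dist (snd p) v + dist (\<sigma> (fst p) v) (\<sigma> s v)) \<longlongrightarrow> 0) ?F"
      by simp
    have "dist (\<sigma> t w) (\<sigma> s v) \<le> dist w v + dist (\<sigma> t v) (\<sigma> s v)" for t w
      using dist_triangle[of "\<sigma> t w" "\<sigma> s v" "\<sigma> t v"] nonexp[of t w v] by linarith
    then have "((\<lambda>p. dist (case p of (t, w) \<Rightarrow> \<sigma> t w) (\<sigma> s v)) \<longlongrightarrow> 0) ?F"
      by (intro tendsto_sandwich[OF _ _ tendsto_const lim] always_eventually) auto
    then show "((\<lambda>(s, v). \<sigma> s v) \<longlongrightarrow> \<sigma> s v) ?F"
      by (simp add: tendsto_dist_iff[of _ "\<sigma> s v"])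
  qed
  then show ?thesis
    unfolding linear_nonexpansive_action_def nonexpansive_action_def
    using maps nonexp mult linear_add[OF lin] linear_scale[OF lin] by auto
qed

section \<open>Gauges that do not increase along orbits\<close>

text \<open>
  A gauge prescribes the distances \<open>\<rho> x\<close> of the points \<open>x\<close> to an added ideal point: the
  two metric conditions are the triangle inequalities for that point, and the last one says
  that the action stays non-expansive when the ideal point is kept fixed. The ideal point is
  going to be the origin of the Banach space.
\<close>

definition invariant_gauge :: "('s \<Rightarrow> 'x::metric_space \<Rightarrow> 'x) \<Rightarrow> 'x set \<Rightarrow> ('x \<Rightarrow> real) \<Rightarrow> bool"
  where "invariant_gauge act X \<rho> \<longleftrightarrow>
    (\<forall>x\<in>X. \<forall>y\<in>X. \<rho> x \<le> \<rho> y + dist x y) \<and>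
    (\<forall>x\<in>X. \<forall>y\<in>X. dist x y \<le> \<rho> x + \<rho> y) \<and>
    (\<forall>s. \<forall>x\<in>X. \<rho> (act s x) \<le> \<rho> x)"

text \<open>
  The supremum of the distances from a base point \<open>c\<close> to the points of the orbit of \<open>x\<close> does not
  increase along orbits, since the orbit of \<open>act s x\<close> is part of the orbit of \<open>x\<close>. The point \<open>x\<close> is
  added to its orbit by hand, because a semigroup need not have a unit: without it the inequality
  \<open>dist x y \<le> \<rho> x + \<rho> y\<close> could fail. The base point may lie outside \<open>X\<close>, so an empty \<open>X\<close> is
  no special case.
\<close>

lemma bounded_orbits_imp_invariant_gauge:
  fixes act :: "'s::topological_semigroup_mult \<Rightarrow> 'x::metric_space \<Rightarrow> 'x"
  assumes act: "nonexpansive_action act X"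
    and bdd: "\<And>x. x \<in> X \<Longrightarrow> bounded (range (\<lambda>s. act s x))"
  shows "\<exists>\<rho>. invariant_gauge act X \<rho>"
proof -
  fix c :: 'x
  define orb where "orb x = insert x (range (\<lambda>s. act s x))" for x
  define \<rho> where "\<rho> x = (SUP z\<in>orb x. dist z c)" for x
  have bdd_orb: "bdd_above ((\<lambda>z. dist z c) ` orb x)" if "x \<in> X" for x
  proof -
    have "bounded (orb x)"
      using bdd[OF that] by (simp add: orb_def)
    then obtain e where "\<forall>z\<in>orb x. dist c z \<le> e"
      using bounded_any_center[of "orb x" c] by blast
    then show ?thesis
      by (auto simp: dist_commute intro!: bdd_aboveI2[of _ _ e])
  qed
  have upper: "dist z c \<le> \<rho> x" if "x \<in> X" "z \<in> orb x" for x z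
    unfolding \<rho>_def using bdd_orb that by (intro cSUP_upper)
  have least: "\<rho> x \<le> r" if "\<And>z. z \<in> orb x \<Longrightarrow> dist z c \<le> r" for x r
    unfolding \<rho>_def using that by (intro cSUP_least) (auto simp: orb_def)
  have "\<rho> x \<le> \<rho> y + dist x y" if "x \<in> X" "y \<in> X" for x y
  proof (rule least)
    fix z assume "z \<in> orb x"
    then have "z = x \<or> (\<exists>s. z = act s x)"
      by (auto simp: orb_def)
    moreover have "dist (act s x) (act s y) \<le> dist x y" for s
      using that act unfolding nonexpansive_action_def by simp
    moreover have "y \<in> orb y" "act s y \<in> orb y" for s
      by (auto simp: orb_def)
    ultimately obtain w where w: "w \<in> orb y" "dist z w \<le> dist x y"
      by blast
    then show "dist z c \<le> \<rho> y + dist x y"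
      using upper[OF that(2) w(1)] dist_triangle[of z c w] by linarith
  qed
  moreover have "dist x y \<le> \<rho> x + \<rho> y" if "x \<in> X" "y \<in> X" for x y
    using upper[of x x] upper[of y y] that dist_triangle2[of x y c] by (simp add: orb_def)
  moreover have "\<rho> (act s x) \<le> \<rho> x" if "x \<in> X" for s x
  proof (rule least)
    have "act t (act s x) = act (t * s) x" for t
      using act that unfolding nonexpansive_action_def by simp
    then have "orb (act s x) \<subseteq> orb x"
      unfolding orb_def by auto
    then show "dist z c \<le> \<rho> x" if "z \<in> orb (act s x)" for z
      using that upper[OF \<open>x \<in> X\<close>] by blast
  qed
  ultimately show ?thesis
    unfolding invariant_gauge_def by blast
qed

section \<open>Linearization by evaluation at Lipschitz functions\<close>

text \<open>
  Every bounded function on a discrete space is continuous, so the abstraction function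
  \<open>Bcontfun\<close> is faithful on it.
\<close>

lemma bounded_function_on_discrete:
  assumes "\<And>\<phi>. \<bar>F \<phi>\<bar> \<le> (b :: real)"
  shows "apply_bcontfun (Bcontfun (\<lambda>\<phi>. F (of_discrete \<phi>))) (discrete \<psi>) = F \<psi>"
proof -
  have "continuous_on UNIV (\<lambda>\<phi>. F (of_discrete \<phi>))"
    by (simp add: continuous_on_open_vimage open_discrete)
  then have "(\<lambda>\<phi>. F (of_discrete \<phi>)) \<in> bcontfun"
    using assms by (intro bcontfun_normI[of _ b]) auto
  then show ?thesis
    by (simp add: Bcontfun_inverse discrete_inverse)
qed

lemma linf_eqI:
  fixes F G :: "'a linf_functions"
  assumes "\<And>\<phi>. apply_bcontfun F (discrete \<phi>) = apply_bcontfun G (discrete \<phi>)"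
  shows "F = G"
proof (rule bcontfun_eqI)
  show "apply_bcontfun F \<phi> = apply_bcontfun G \<phi>" for \<phi>
    using assms[of "of_discrete \<phi>"] by (simp add: of_discrete_inverse)
qed

locale gauged_action =
  fixes act :: "'s::topological_semigroup_mult \<Rightarrow> 'x::metric_space \<Rightarrow> 'x"
    and X :: "'x set" and \<rho> :: "'x \<Rightarrow> real"
  assumes act: "nonexpansive_action act X"
    and gauge: "invariant_gauge act X \<rho>"
begin

lemma act_in: "x \<in> X \<Longrightarrow> act s x \<in> X"
  and act_mult: "x \<in> X \<Longrightarrow> act (s * t) x = act s (act t x)"
  and act_dist: "x \<in> X \<Longrightarrow> y \<in> X \<Longrightarrow> dist (act s x) (act s y) \<le> dist x y"
  using act unfolding nonexpansive_action_def by auto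

lemma gauge_lipschitz: "x \<in> X \<Longrightarrow> y \<in> X \<Longrightarrow> \<rho> x \<le> \<rho> y + dist x y"
  and dist_le_gauge: "x \<in> X \<Longrightarrow> y \<in> X \<Longrightarrow> dist x y \<le> \<rho> x + \<rho> y"
  and gauge_act: "x \<in> X \<Longrightarrow> \<rho> (act s x) \<le> \<rho> x"
  using gauge unfolding invariant_gauge_def by auto

lemma orbit_map_continuous:
  assumes "x \<in> X"
  shows "continuous_on UNIV (\<lambda>s. act s x)"
proof -
  have "continuous_on (UNIV \<times> X) (\<lambda>(s, x). act s x)"
    using act unfolding nonexpansive_action_def by simp
  then have "continuous_on UNIV (\<lambda>s. case (s, x) of (s, x) \<Rightarrow> act s x)"
    by (rule continuous_on_compose2) (use assms in \<open>auto intro!: continuous_intros\<close>)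
  then show ?thesis by simp
qed

text \<open>
  With the ideal point added to \<open>X\<close>, these are the 1-Lipschitz functions that vanish there.
  Fixing the value 0 off \<open>X\<close> makes a function determined by its restriction to \<open>X\<close>, where alone
  \<open>act\<close> obeys the laws of an action.
\<close>

definition lips :: "('x \<Rightarrow> real) set" where
  "lips = {\<phi>. (\<forall>x\<in>X. \<forall>y\<in>X. \<bar>\<phi> x - \<phi> y\<bar> \<le> dist x y) \<and> (\<forall>x\<in>X. \<bar>\<phi> x\<bar> \<le> \<rho> x) \<and> (\<forall>x. x \<notin> X \<longrightarrow> \<phi> x = 0)}"

definition pullback :: "'s \<Rightarrow> ('x \<Rightarrow> real) \<Rightarrow> 'x \<Rightarrow> real" where
  "pullback s \<phi> x = (if x \<in> X then \<phi> (act s x) else 0)"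

lemma lipsD:
  assumes "\<phi> \<in> lips"
  shows "x \<in> X \<Longrightarrow> y \<in> X \<Longrightarrow> \<bar>\<phi> x - \<phi> y\<bar> \<le> dist x y"
    and "x \<in> X \<Longrightarrow> \<bar>\<phi> x\<bar> \<le> \<rho> x"
    and "x \<notin> X \<Longrightarrow> \<phi> x = 0"
  using assms unfolding lips_def by auto

lemma pullback_lips:
  assumes "\<phi> \<in> lips"
  shows "pullback s \<phi> \<in> lips"
proof -
  have "\<bar>\<phi> (act s x) - \<phi> (act s y)\<bar> \<le> dist x y" if "x \<in> X" "y \<in> X" for x y
    using lipsD(1)[OF assms act_in act_in] act_dist that by (meson order_trans)
  moreover have "\<bar>\<phi> (act s x)\<bar> \<le> \<rho> x" if "x \<in> X" for x
    using lipsD(2)[OF assms act_in] gauge_act that by (meson order_trans)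
  ultimately show ?thesis
    unfolding lips_def pullback_def by auto
qed

lemma pullback_mult: "pullback (s * t) \<phi> = pullback t (pullback s \<phi>)"
  by (auto simp: pullback_def fun_eq_iff act_mult act_in)

text \<open>
  Since \<open>\<rho> y\<close> is the distance from \<open>y\<close> to the ideal point, subtracting it makes the distance
  function of \<open>y\<close> vanish there. This function witnesses that evaluation does not shrink any
  distance to \<open>y\<close>.
\<close>

lemma shifted_dist_lips:
  assumes "y \<in> X"
  shows "(\<lambda>u. if u \<in> X then dist u y - \<rho> y else 0) \<in> lips"
proof -
  have "\<bar>(dist u y - \<rho> y) - (dist v y - \<rho> y)\<bar> \<le> dist u v" for u v
    using abs_dist_diff_le[of u y v] by (simp add: dist_commute)
  moreover have "\<bar>dist u y - \<rho> y\<bar> \<le> \<rho> u" if "u \<in> X" for u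
    using dist_le_gauge[OF that assms] gauge_lipschitz[OF assms that] by (simp add: dist_commute)
  ultimately show ?thesis
    unfolding lips_def by auto
qed

text \<open>
  The cutoff to \<open>lips\<close> identifies bounded functions on \<open>lips\<close> with bounded functions on the
  larger index type; it is also what bounds the evaluation functionals.
\<close>

definition evaluation :: "'x \<Rightarrow> 'x linf_functions" where
  "evaluation x = Bcontfun (\<lambda>\<phi>. if of_discrete \<phi> \<in> lips then of_discrete \<phi> x else 0)"

definition shift :: "'s \<Rightarrow> 'x linf_functions \<Rightarrow> 'x linf_functions" where
  "shift s F = Bcontfun (\<lambda>\<phi>. if of_discrete \<phi> \<in> lips
     then apply_bcontfun F (discrete (pullback s (of_discrete \<phi>))) else 0)"

lemma evaluation_apply:
  "apply_bcontfun (evaluation x) (discrete \<phi>) = (if \<phi> \<in> lips then \<phi> x else 0)"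
  unfolding evaluation_def
proof (rule bounded_function_on_discrete)
  show "\<bar>if \<phi> \<in> lips then \<phi> x else 0\<bar> \<le> \<bar>\<rho> x\<bar>" for \<phi>
    using lipsD(2)[of \<phi> x] lipsD(3)[of \<phi> x] by (cases "x \<in> X") auto
qed

lemma shift_apply:
  "apply_bcontfun (shift s F) (discrete \<phi>) =
    (if \<phi> \<in> lips then apply_bcontfun F (discrete (pullback s \<phi>)) else 0)"
  unfolding shift_def
proof (rule bounded_function_on_discrete)
  show "\<bar>if \<phi> \<in> lips then apply_bcontfun F (discrete (pullback s \<phi>)) else 0\<bar> \<le> norm F" for \<phi>
    using norm_bounded[of F "discrete (pullback s \<phi>)"] by simp
qed

lemma linear_shift: "linear (shift s)"
proof (rule linearI)
  show "shift s (F + G) = shift s F + shift s G" for F G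
    by (rule linf_eqI) (simp add: shift_apply)
  show "shift s (c *\<^sub>R F) = c *\<^sub>R shift s F" for c F
    by (rule linf_eqI) (simp add: shift_apply)
qed

lemma norm_shift_le: "norm (shift s F) \<le> norm F"
proof (rule norm_bound)
  fix \<phi>
  have "norm (apply_bcontfun (shift s F) (discrete \<psi>)) \<le> norm F" for \<psi>
    using norm_bounded[of F "discrete (pullback s \<psi>)"] by (simp add: shift_apply)
  then show "norm (apply_bcontfun (shift s F) \<phi>) \<le> norm F"
    by (metis of_discrete_inverse)
qed

text \<open>
  Pulling back reverses the order of a product, and acting on functions of pulled back functions
  reverses it again, which leaves a left action.
\<close>

lemma shift_mult: "shift (s * t) F = shift s (shift t F)"
  by (rule linf_eqI) (simp add: shift_apply pullback_lips pullback_mult)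

lemma shift_evaluation:
  assumes "x \<in> X"
  shows "shift s (evaluation x) = evaluation (act s x)"
  by (rule linf_eqI)
    (use assms in \<open>simp add: shift_apply evaluation_apply pullback_lips pullback_def\<close>)

lemma dist_evaluation:
  assumes "x \<in> X" "y \<in> X"
  shows "dist (evaluation x) (evaluation y) = dist x y"
proof (rule antisym)
  show "dist (evaluation x) (evaluation y) \<le> dist x y"
  proof (rule dist_bound)
    fix \<phi>
    have "dist (apply_bcontfun (evaluation x) (discrete \<psi>))
        (apply_bcontfun (evaluation y) (discrete \<psi>)) \<le> dist x y" for \<psi>
      using lipsD(1)[of \<psi> x y] assms by (simp add: evaluation_apply dist_real_def)
    then show "dist (apply_bcontfun (evaluation x) \<phi>) (apply_bcontfun (evaluation y) \<phi>) \<le> dist x y"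
      by (metis of_discrete_inverse)
  qed
next
  let ?\<phi> = "\<lambda>u. if u \<in> X then dist u y - \<rho> y else 0"
  have "dist x y = dist (apply_bcontfun (evaluation x) (discrete ?\<phi>))
      (apply_bcontfun (evaluation y) (discrete ?\<phi>))"
    using assms shifted_dist_lips[OF assms(2)] by (simp add: evaluation_apply dist_real_def)
  also have "\<dots> \<le> dist (evaluation x) (evaluation y)"
    by (rule dist_bounded)
  finally show "dist x y \<le> dist (evaluation x) (evaluation y)" .
qed

lemma evaluation_orbit_map_continuous:
  assumes "x \<in> X"
  shows "continuous_on UNIV (\<lambda>s. evaluation (act s x))"
proof -
  have "continuous_on X evaluation"
    unfolding continuous_on_iff by (auto simp: dist_evaluation)
  then show ?thesis
    by (rule continuous_on_compose2[OF _ orbit_map_continuous[OF assms]])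
      (auto simp: act_in assms)
qed

lemma linearizable: "linearizable_in TYPE('x linf_functions) act X"
proof -
  let ?V = "closure (span (evaluation ` X))"
  have "linear_nonexpansive_action shift ?V"
    by (rule linear_nonexpansive_action_closed_span)
      (auto simp: linear_shift norm_shift_le shift_mult shift_evaluation act_in
        evaluation_orbit_map_continuous)
  moreover have "equivariant_isometric_embedding act X shift ?V evaluation"
    unfolding equivariant_isometric_embedding_def
    using closure_subset span_superset by (fastforce simp: dist_evaluation shift_evaluation)
  moreover have "subspace ?V"
    by (simp add: closure_subspace)
  moreover have "complete ?V"
    by (simp add: complete_eq_closed)
  ultimately show ?thesis
    unfolding linearizable_in_def by blast
qed

end

section \<open>The equivalence\<close>

text \<open>
  A linear action fixes the origin, so non-expansivity confines each orbit to a ball around it,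
  and an isometric embedding transfers this bound back.
\<close>

lemma linearizable_imp_bounded_orbits:
  fixes act :: "'s::topological_semigroup_mult \<Rightarrow> 'x::metric_space \<Rightarrow> 'x"
  assumes act: "nonexpansive_action act X"
    and lin: "linearizable_in TYPE('v::real_normed_vector) act X"
    and x: "x \<in> X"
  shows "bounded (range (\<lambda>s. act s x))"
proof -
  obtain V :: "'v set" and \<sigma> f where V: "subspace V" and \<sigma>: "linear_nonexpansive_action \<sigma> V"
    and f: "equivariant_isometric_embedding act X \<sigma> V f"
    using lin unfolding linearizable_in_def by blast
  have fx: "f x \<in> V"
    using f x unfolding equivariant_isometric_embedding_def by auto
  have in_X: "act s x \<in> X" for s
    using act x unfolding nonexpansive_action_def by auto
  have norm_le: "norm (f (act s x)) \<le> norm (f x)" for s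
  proof -
    have "\<sigma> s (0 *\<^sub>R f x) = 0 *\<^sub>R \<sigma> s (f x)"
      using \<sigma> fx unfolding linear_nonexpansive_action_def by blast
    then have zero: "\<sigma> s 0 = 0"
      by simp
    have "dist (\<sigma> s (f x)) (\<sigma> s 0) \<le> dist (f x) 0"
      using \<sigma> fx subspace_0[OF V]
      unfolding linear_nonexpansive_action_def nonexpansive_action_def by blast
    moreover have "f (act s x) = \<sigma> s (f x)"
      using f x unfolding equivariant_isometric_embedding_def by blast
    ultimately show ?thesis
      by (simp add: zero)
  qed
  have "dist x (act s x) \<le> 2 * norm (f x)" for s
  proof -
    have "dist x (act s x) = norm (f x - f (act s x))"
      using f x in_X unfolding equivariant_isometric_embedding_def by (metis dist_norm)
    also have "\<dots> \<le> 2 * norm (f x)"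
      using norm_triangle_ineq4[of "f x" "f (act s x)"] norm_le[of s] by linarith
    finally show ?thesis .
  qed
  then show ?thesis
    unfolding bounded_def by blast
qed

lemma bounded_orbits_imp_linearizable:
  fixes act :: "'s::topological_semigroup_mult \<Rightarrow> 'x::metric_space \<Rightarrow> 'x"
  assumes act: "nonexpansive_action act X"
    and bdd: "\<And>x. x \<in> X \<Longrightarrow> bounded (range (\<lambda>s. act s x))"
  shows "linearizable_in TYPE('x linf_functions) act X"
proof -
  obtain \<rho> where "invariant_gauge act X \<rho>"
    using bounded_orbits_imp_invariant_gauge[OF assms] by blast
  then interpret gauged_action act X \<rho>
    using act by unfold_locales
  show ?thesis
    by (rule linearizable)
qed

theorem theorem7:
  fixes act :: "'s::topological_semigroup_mult \<Rightarrow> 'x::metric_space \<Rightarrow> 'x"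
    and X :: "'x set"
  assumes "nonexpansive_action act X"
  shows "(linearizable_in TYPE('x linf_functions) act X
            \<longleftrightarrow> (\<forall>x\<in>X. bounded (range (\<lambda>s. act s x))))
       \<and> (linearizable_in TYPE('v::real_normed_vector) act X
            \<longrightarrow> (\<forall>x\<in>X. bounded (range (\<lambda>s. act s x))))"
proof (intro conjI iffI impI ballI)
  show "bounded (range (\<lambda>s. act s x))"
    if "linearizable_in TYPE('x linf_functions) act X" "x \<in> X" for x
    using linearizable_imp_bounded_orbits[OF assms that] .
  show "linearizable_in TYPE('x linf_functions) act X"
    if "\<forall>x\<in>X. bounded (range (\<lambda>s. act s x))"
    using bounded_orbits_imp_linearizable[OF assms] that by simp
  show "bounded (range (\<lambda>s. act s x))"
    if "linearizable_in TYPE('v) act X" "x \<in> X" for x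
    using linearizable_imp_bounded_orbits[OF assms that] .
qed

end
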